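(* Let $R=(R(t))_{t\ge 0}$ be a risk reserve process with $R(0)=u>0$ satisfying conditions (i) and (ii) of the context, and assume that the random variables $Y_k:=R(T_{k-1})-R(T_k)$, $k=1,2,\ldots$, are mutually independent. Let $S_k:=Y_1+\cdots+Y_k$. Suppose that there exists an integer $l\ge1$ such that for all $n=1,2,\ldots$ the random variables $Y_{n+l}$ and $Y_n$ are identically distributed. Put $$L(S_l):=\sup\big\{h\ge0:\ \mathbf{E}e^{hS_l}\le1\big\}.$$ Then for any $u>0$ and $h\ge 0$ $$\psi(u)=\mathbf{P}\Big[\sup_{k\ge 1}S_k>u\Big]\le e^{-hu}\sup_{k\ge1}\mathbf{E}e^{hS_k}=e^{-hu}\sup_{k\ge 1}\prod_{j=1}^k\mathbf{E}e^{hY_j},$$ with $$\sup_{k\ge1}\mathbf{E}e^{hS_k}=\max_{1\le k\le l}\mathbf{E}e^{hS_k}\quad\text{for each } h\in[0,L(S_l)].$$ Moreover, for any $u>0$ $$\psi(u)\le\inf_{h\in[0,L(S_l)]}\Big\{e^{-hu}\max_{1\le k\le l}\mathbf{E}e^{hS_k}\Big\}\le C_1e^{-L(S_l)u}\qquad\text{with}\qquad C_1=\max_{1\le k\le l}\mathbf{E}e^{L(S_l)S_k}.$$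
   Context: $R(t)$, $t\ge 0$, is a risk reserve process (a real-valued stochastic process) with non-random initial reserve $R(0)=u>0$. The ultimate ruin probability is $\psi(u):=\mathbf{P}[\inf_{t\ge 0}R(t)<0\mid R(0)=u]$. Conditions: (i) The process $R(t)$ may have positive jumps only at random or non-random times $T_1,T_2,\ldots$ such that $T_{k+1}>T_k>T_0:=0$ for all $k=1,2,\ldots$ and $T_n\to\infty$ almost surely. (ii) The process $R(t)$ is monotone on each time interval $[T_{k-1},T_k)$, $k=1,2,\ldots$, and $R(0)=u>0$. Convention: expectations $\mathbf{E}e^{hS}$ with $h\ge0$ take values in $(0,\infty]$; an upper bound for $\psi(u)$ may be $+\infty$, in which case it is trivial.
   Formalization: Added: a positive jump of R at T_k occurs only if R is nondecreasing on [T_{k-1},T_k). Else false: R may fall below 0 and jump back to u at each T_k, so all Y_k=0 but ψ(u)=1. The ruin event is also assumed measurable, so that ψ(u) is defined. *)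

theory Defs
  imports "HOL-Probability.Probability"
begin

(* Paths are functions on the reals, of which only the values at t \<ge> 0 matter.
   A jump at t > 0 is r(t) - r(t-).  The left limit is taken in the extended reals, since a
   monotone path may be unbounded to the left of t. *)
definition positive_jump :: "(real \<Rightarrow> real) \<Rightarrow> real \<Rightarrow> bool" where
  "positive_jump r t \<longleftrightarrow>
     t > 0 \<and> (\<exists>a::ereal. ((\<lambda>s. ereal (r s)) \<longlongrightarrow> a) (at_left t) \<and> a < ereal (r t))"

definition ruin :: "(real \<Rightarrow> 'a \<Rightarrow> real) \<Rightarrow> 'a \<Rightarrow> bool" where
  "ruin R \<omega> \<longleftrightarrow> (INF t\<in>{0..}. ereal (R t \<omega>)) < 0"

definition ruin_prob :: "'a measure \<Rightarrow> (real \<Rightarrow> 'a \<Rightarrow> real) \<Rightarrow> real \<Rightarrow> real" where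
  "ruin_prob M R u = \<P>(\<omega> in M. ruin R \<omega> \<bar> R 0 \<omega> = u)"

definition net_loss :: "(real \<Rightarrow> 'a \<Rightarrow> real) \<Rightarrow> (nat \<Rightarrow> 'a \<Rightarrow> real) \<Rightarrow> nat \<Rightarrow> 'a \<Rightarrow> real" where
  "net_loss R T k \<omega> = R (T (k - 1) \<omega>) \<omega> - R (T k \<omega>) \<omega>"

definition total_loss :: "(real \<Rightarrow> 'a \<Rightarrow> real) \<Rightarrow> (nat \<Rightarrow> 'a \<Rightarrow> real) \<Rightarrow> nat \<Rightarrow> 'a \<Rightarrow> real" where
  "total_loss R T k \<omega> = (\<Sum>j=1..k. net_loss R T j \<omega>)"

definition exp_ereal :: "ereal \<Rightarrow> ennreal" where
  "exp_ereal x = (if x = \<infinity> then \<infinity> else if x = -\<infinity> then 0 else ennreal (exp (real_of_ereal x)))"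

lemma exp_ereal_simps [simp]:
  "exp_ereal (ereal x) = ennreal (exp x)" "exp_ereal \<infinity> = \<infinity>" "exp_ereal (-\<infinity>) = 0"
  by (simp_all add: exp_ereal_def)

(* E exp(h X), with values up to infinity.  The value h = \<infinity> occurs when adjustment is infinite;
   there \<infinity> * 0 = 0 in ereal, so the integrand is the pointwise limit of exp(h X) as h grows:
   \<infinity>, 1 or 0 according to the sign of X. *)
definition exp_moment :: "'a measure \<Rightarrow> ereal \<Rightarrow> ('a \<Rightarrow> real) \<Rightarrow> ennreal" where
  "exp_moment M h X = (\<integral>\<^sup>+ \<omega>. exp_ereal (h * ereal (X \<omega>)) \<partial>M)"

lemma exp_moment_ereal:
  "exp_moment M (ereal h) X = (\<integral>\<^sup>+ \<omega>. ennreal (exp (h * X \<omega>)) \<partial>M)"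
  by (simp add: exp_moment_def)

definition adjustment :: "'a measure \<Rightarrow> ('a \<Rightarrow> real) \<Rightarrow> ereal" where
  "adjustment M X = Sup {ereal h | h. 0 \<le> h \<and> exp_moment M (ereal h) X \<le> 1}"

(* The bound c * x with an infinite constant c, which is the trivial bound \<infinity> even for x = 0,
   whereas \<infinity> * 0 = 0 in ennreal.  This only matters for x = exp(-L u) with L = \<infinity>. *)
definition bound_times :: "ennreal \<Rightarrow> ennreal \<Rightarrow> ennreal" where
  "bound_times c x = (if c = \<infinity> then \<infinity> else c * x)"

end

theory Submission
  imports Defs
begin

text \<open>
  On an interval where the path increases, its infimum is attained at the left end; where it
  decreases, the absence of a positive jump at the right end puts the value there below the
  whole interval. So ruin occurs iff \<open>R (T k) < 0\<close>, that is \<open>S k > u\<close>, for some \<open>k\<close>. Stopping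
  the martingale \<open>exp (h S\<^sub>k) / E exp (h S\<^sub>k)\<close> at the first passage above \<open>u\<close> gives the
  exponential bound. If \<open>h \<le> L\<close>, then \<open>E exp (h S\<^sub>l) \<le> 1\<close> (convexity below \<open>L\<close>, Fatou at
  \<open>L\<close>), so by periodicity adding \<open>l\<close> to \<open>k\<close> never increases the product of moments and the
  supremum is reached among \<open>k \<le> l\<close>.
\<close>

section \<open>Ruin seen from the times \<open>t k\<close>\<close>

text \<open>The left limit of a decreasing path at \<open>b\<close> is its infimum over the
  interval, possibly minus infinity. Without a positive jump, \<open>r b\<close> cannot exceed that
  limit; \<open>0 \<le> a\<close> makes \<open>b\<close> positive, so that
  \<open>positive_jump\<close> speaks about \<open>b\<close>.\<close>

lemma decreasing_path_ge_endpoint: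
  fixes r :: "real \<Rightarrow> real"
  assumes "0 \<le> a" "antimono_on {a..<b} r" "\<not> positive_jump r b" "a \<le> s" "s < b"
  shows "r b \<le> r s"
proof -
  define c where "c = (INF x\<in>{a..<b}. ereal (r x))"
  have "((\<lambda>x. ereal (r x)) \<longlongrightarrow> c) (at_left b)"
  proof (rule decreasing_tendsto)
    have "eventually (\<lambda>x. x \<in> {a..<b}) (at_left b)"
      using assms by (auto simp: eventually_at_left intro!: exI[of _ a])
    then show "eventually (\<lambda>x. c \<le> ereal (r x)) (at_left b)"
      by eventually_elim (auto simp: c_def intro: INF_lower)
  next
    fix y assume "c < y"
    then obtain x where x: "a \<le> x" "x < b" "ereal (r x) < y"
      unfolding c_def INF_less_iff by auto
    have "eventually (\<lambda>z. x < z \<and> z < b) (at_left b)"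
      using x by (auto simp: eventually_at_left intro!: exI[of _ x])
    then show "eventually (\<lambda>z. ereal (r z) < y) (at_left b)"
    proof eventually_elim
      case (elim z)
      then have "r z \<le> r x"
        using assms(2) x by (auto simp: monotone_on_def)
      then show ?case using x(3) by (meson ereal_less_eq(3) le_less_trans)
    qed
  qed
  then have "ereal (r b) \<le> c"
    using assms unfolding positive_jump_def by (metis le_less_trans not_less)
  also have "c \<le> ereal (r s)"
    using assms by (auto simp: c_def intro: INF_lower)
  finally show ?thesis by simp
qed

text \<open>A statement about one path. Every \<open>s \<ge> 0\<close> lies in some interval between
  consecutive times, and the value at one of the two ends is at most \<open>r s\<close>: the left
  end if the path increases there, the right end otherwise. The infimum itself need not be
  attained.\<close>

lemma INF_path_less_iff:
  fixes r :: "real \<Rightarrow> real" and t :: "nat \<Rightarrow> real"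
  assumes t0: "t 0 = 0" and inc: "\<And>k. t k < t (Suc k)"
    and lim: "filterlim t at_top sequentially"
    and mon: "\<And>k. k \<ge> 1 \<Longrightarrow> mono_on {t (k - 1)..<t k} r \<or> antimono_on {t (k - 1)..<t k} r"
    and jump: "\<And>k. k \<ge> 1 \<Longrightarrow> positive_jump r (t k) \<Longrightarrow> mono_on {t (k - 1)..<t k} r"
  shows "(INF s\<in>{0..}. ereal (r s)) < ereal c \<longleftrightarrow> (\<exists>k. r (t k) < c)"
proof -
  have "strict_mono t" using inc by (rule strict_monoI_Suc)
  have nonneg: "0 \<le> t k" for k
    using strict_mono_less_eq[OF \<open>strict_mono t\<close>, of 0 k] t0 by simp
  have "\<exists>k. r (t k) \<le> r s" if "0 \<le> s" for s
  proof -
    have "\<exists>k. s < t k"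
      using lim unfolding filterlim_at_top_dense
      by (metis eventually_happens' sequentially_bot)
    \<comment> \<open>Minimality of \<open>k\<close> puts \<open>s\<close> to the right of
      \<open>t (k - 1)\<close>; since \<open>t 0 = 0 \<le> s\<close>, this \<open>k\<close> is not
      0.\<close>
    then obtain k where k: "s < t k" "\<And>j. j < k \<Longrightarrow> \<not> s < t j"
      using exists_least_iff[of "\<lambda>k. s < t k"] by blast
    from k(1) that t0 have "k \<ge> 1" by (cases k) auto
    with k have s: "t (k - 1) \<le> s" by (simp add: not_less)
    consider "mono_on {t (k - 1)..<t k} r"
      | "antimono_on {t (k - 1)..<t k} r" "\<not> positive_jump r (t k)"
      using mon[OF \<open>k \<ge> 1\<close>] jump[OF \<open>k \<ge> 1\<close>] by blast
    then show ?thesis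
    proof cases
      case 1
      then have "r (t (k - 1)) \<le> r s"
        using s k(1) by (auto simp: monotone_on_def)
      then show ?thesis by blast
    next
      case 2
      then show ?thesis
        using decreasing_path_ge_endpoint[OF nonneg] s k(1) by blast
    qed
  qed
  then show ?thesis
    unfolding INF_less_iff using nonneg
    by (metis atLeast_iff less_ereal.simps(1) le_less_trans)
qed

section \<open>Independence and products of expectations\<close>

lemma (in prob_space) indep_var_nn_integral_mult:
  fixes X Y :: "'a \<Rightarrow> ennreal"
  assumes "indep_var borel X borel Y"
  shows "(\<integral>\<^sup>+\<omega>. X \<omega> * Y \<omega> \<partial>M) = (\<integral>\<^sup>+\<omega>. X \<omega> \<partial>M) * (\<integral>\<^sup>+\<omega>. Y \<omega> \<partial>M)"
proof -
  \<comment> \<open>\<open>indep_var\<close> is independence of a family indexed by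
    \<open>bool\<close>; with a constant target space the product rule for families applies.\<close>
  have "case_bool borel borel = (\<lambda>_. borel :: ennreal measure)"
    by (auto simp: fun_eq_iff split: bool.split)
  then have "indep_vars (\<lambda>_. borel) (case_bool X Y) (UNIV :: bool set)"
    using assms by (simp add: indep_var_def)
  then have "(\<integral>\<^sup>+\<omega>. (\<Prod>b\<in>UNIV. case_bool X Y b \<omega>) \<partial>M) = (\<Prod>b\<in>UNIV. \<integral>\<^sup>+\<omega>. case_bool X Y b \<omega> \<partial>M)"
    by (intro indep_vars_nn_integral) auto
  then show ?thesis by (simp add: UNIV_bool mult.commute)
qed

text \<open>This replaces conditioning on the past in the martingale argument. \<open>F\<close> sees
  the whole prefix because the weight used later depends on all earlier partial sums; disjoint index
  sets give the independence.\<close>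

lemma (in prob_space) nn_integral_prefix_mult_next:
  fixes X :: "nat \<Rightarrow> 'a \<Rightarrow> real" and F :: "(nat \<Rightarrow> real) \<Rightarrow> ennreal"
  assumes indep: "indep_vars (\<lambda>_. borel) X {1..}"
    and F: "F \<in> borel_measurable (PiM {1..n} (\<lambda>_. borel))"
    and g: "g \<in> borel_measurable borel"
  shows "(\<integral>\<^sup>+\<omega>. F (restrict (\<lambda>i. X i \<omega>) {1..n}) * g (X (Suc n) \<omega>) \<partial>M)
       = (\<integral>\<^sup>+\<omega>. F (restrict (\<lambda>i. X i \<omega>) {1..n}) \<partial>M) * (\<integral>\<^sup>+\<omega>. g (X (Suc n) \<omega>) \<partial>M)"
proof -
  have g': "(\<lambda>x. g (x (Suc n))) \<in> borel_measurable (PiM {Suc n} (\<lambda>_. borel))"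
    using g by measurable
  have "indep_var (PiM {1..n} (\<lambda>_. borel)) (\<lambda>\<omega>. restrict (\<lambda>i. X i \<omega>) {1..n})
     (PiM {Suc n} (\<lambda>_. borel)) (\<lambda>\<omega>. restrict (\<lambda>i. X i \<omega>) {Suc n})"
    by (rule indep_var_restrict[OF indep]) auto
  from indep_var_nn_integral_mult[OF indep_var_compose[OF this F g']]
  show ?thesis by (simp add: comp_def)
qed

lemma exp_moment_sum:
  fixes X :: "nat \<Rightarrow> 'a \<Rightarrow> real"
  assumes "prob_space M" and indep: "prob_space.indep_vars M (\<lambda>_. borel) X {1..}"
  shows "exp_moment M (ereal h) (\<lambda>\<omega>. \<Sum>j=1..k. X j \<omega>) = (\<Prod>j=1..k. exp_moment M (ereal h) (X j))"
proof -
  interpret prob_space M by fact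
  have "indep_vars (\<lambda>_. borel) X {1..k}"
    using indep by (rule indep_vars_subset) auto
  then have "indep_vars (\<lambda>_. borel) (\<lambda>j \<omega>. ennreal (exp (h * X j \<omega>))) {1..k}"
    by (rule indep_vars_compose2) simp
  then have "(\<integral>\<^sup>+\<omega>. (\<Prod>j=1..k. ennreal (exp (h * X j \<omega>))) \<partial>M)
      = (\<Prod>j=1..k. \<integral>\<^sup>+\<omega>. ennreal (exp (h * X j \<omega>)) \<partial>M)"
    by (intro indep_vars_nn_integral) auto
  then show ?thesis
    by (simp add: exp_moment_ereal sum_distrib_left exp_sum prod_ennreal)
qed

text \<open>Needed to cancel products of moments in the maximal inequality. The integrand is
  positive everywhere and the space is not null.\<close>

lemma exp_moment_pos:
  assumes "prob_space M" "X \<in> borel_measurable M"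
  shows "0 < exp_moment M (ereal h) X"
proof -
  interpret prob_space M by fact
  have "exp_moment M (ereal h) X \<noteq> 0"
    using assms(2) by (auto simp: exp_moment_ereal nn_integral_0_iff_AE)
  then show ?thesis by (simp add: zero_less_iff_neq_zero)
qed

section \<open>The exponential maximal inequality\<close>

text \<open>The moments may lie on either side of 1 and may be infinite. The proof follows the
  exponential weight of the paths that have not yet passed \<open>u\<close>: one more summand
  multiplies it by the next moment, and the paths passing at that step carry weight at least
  \<open>exp (h * u)\<close> each.\<close>

lemma maximal_inequality_exp_sum:
  fixes X :: "nat \<Rightarrow> 'a \<Rightarrow> real"
  assumes "prob_space M" and indep: "prob_space.indep_vars M (\<lambda>_. borel) X {1..}" and "h \<ge> 0"
  defines "S \<equiv> \<lambda>n \<omega>. \<Sum>j=1..n. X j \<omega>"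
  shows "emeasure M {\<omega>\<in>space M. \<exists>k\<ge>1. u < S k \<omega>}
    \<le> ennreal (exp (- h * u)) * (SUP k\<in>{1..}. \<Prod>j=1..k. exp_moment M (ereal h) (X j))"
proof -
  interpret prob_space M by fact
  define m where "m j = exp_moment M (ereal h) (X j)" for j
  define P where "P n = (\<Prod>j=1..n. m j)" for n
  define D where "D = (SUP k\<in>{1..}. P k)"
  \<comment> \<open>In terms of the first passage time above \<open>u\<close>: it is later than
    \<open>n\<close> on \<open>G n\<close>, at most \<open>n\<close> on \<open>A n\<close>, and
    equal to \<open>Suc n\<close> on \<open>B n\<close>. \<open>E n\<close> is the weight not yet
    stopped.\<close>
  define G where "G n \<omega> \<longleftrightarrow> (\<forall>k\<in>{1..n}. S k \<omega> \<le> u)" for n \<omega>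
  define A where "A n = {\<omega>\<in>space M. \<not> G n \<omega>}" for n
  define B where "B n = {\<omega>\<in>space M. G n \<omega> \<and> \<not> G (Suc n) \<omega>}" for n
  define E where "E n = (\<integral>\<^sup>+\<omega>. (if G n \<omega> then ennreal (exp (h * S n \<omega>)) else 0) \<partial>M)" for n
  define e where "e = ennreal (exp (h * u))"
  have X [measurable]: "j \<ge> 1 \<Longrightarrow> X j \<in> borel_measurable M" for j
    using indep by (auto simp: indep_vars_def)
  have S [measurable]: "S n \<in> borel_measurable M" for n
    unfolding S_def by (intro borel_measurable_sum X) auto
  have G [measurable]: "Measurable.pred M (G n)" for n
    unfolding G_def by measurable
  have [measurable]: "A n \<in> sets M" "B n \<in> sets M" for n
    unfolding A_def B_def by measurable
  have PD: "P n \<le> D" if "n \<ge> 1" for n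
    unfolding D_def using that by (intro SUP_upper) auto
  have step: "E (Suc n) + e * emeasure M (B n) \<le> E n * m (Suc n)" for n
  proof -
    \<comment> \<open>The weight inside \<open>E n\<close>, rewritten as a function of the first
      \<open>n\<close> coordinates so that it is independent of \<open>X (Suc n)\<close>.\<close>
    let ?F = "\<lambda>x. if \<forall>k\<in>{1..n}. (\<Sum>j=1..k. x j) \<le> u then ennreal (exp (h * (\<Sum>j=1..n. x j))) else 0"
    let ?g = "\<lambda>x. ennreal (exp (h * x))"
    have F: "?F \<in> borel_measurable (PiM {1..n} (\<lambda>_. borel))"
      by measurable
    have FX: "?F (restrict (\<lambda>i. X i \<omega>) {1..n}) = (if G n \<omega> then ennreal (exp (h * S n \<omega>)) else 0)" for \<omega>
      by (auto simp: G_def S_def)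
    have "E (Suc n) + e * emeasure M (B n)
      = (\<integral>\<^sup>+\<omega>. (if G (Suc n) \<omega> then ennreal (exp (h * S (Suc n) \<omega>)) else 0) + e * indicator (B n) \<omega> \<partial>M)"
      unfolding E_def by (subst nn_integral_add) (auto simp: nn_integral_cmult_indicator)
    \<comment> \<open>On \<open>G n\<close> the new weight is either kept, or it belongs to
      \<open>B n\<close>, where \<open>h \<ge> 0\<close> makes it at least \<open>e\<close>.\<close>
    also have "\<dots> \<le> (\<integral>\<^sup>+\<omega>. ?F (restrict (\<lambda>i. X i \<omega>) {1..n}) * ?g (X (Suc n) \<omega>) \<partial>M)"
    proof (intro nn_integral_mono)
      fix \<omega> assume "\<omega> \<in> space M"
      have eq: "(if G n \<omega> then ennreal (exp (h * S n \<omega>)) else 0) * ?g (X (Suc n) \<omega>)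
          = (if G n \<omega> then ennreal (exp (h * S (Suc n) \<omega>)) else 0)"
        by (simp add: S_def ennreal_mult'[symmetric] exp_add[symmetric] distrib_left)
      have Suc: "G (Suc n) \<omega> \<longleftrightarrow> G n \<omega> \<and> S (Suc n) \<omega> \<le> u"
        by (auto simp: G_def le_Suc_eq)
      have le: "e \<le> ennreal (exp (h * S (Suc n) \<omega>))" if "\<not> S (Suc n) \<omega> \<le> u"
        using that \<open>h \<ge> 0\<close> by (auto simp: e_def intro!: ennreal_leI mult_left_mono)
      show "(if G (Suc n) \<omega> then ennreal (exp (h * S (Suc n) \<omega>)) else 0) + e * indicator (B n) \<omega>
          \<le> ?F (restrict (\<lambda>i. X i \<omega>) {1..n}) * ?g (X (Suc n) \<omega>)"
        unfolding FX eq using le by (auto simp: B_def Suc indicator_def)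
    qed
    also have "\<dots> = E n * m (Suc n)"
      using nn_integral_prefix_mult_next[OF indep F, of ?g]
      by (simp only: FX E_def m_def exp_moment_ereal) simp
    finally show ?thesis .
  qed
  \<comment> \<open>The optional stopping identity for the martingale \<open>exp (h S\<^sub>n) / P\<^sub>n\<close>,
      weakened by \<open>P\<^sub>k \<le> D\<close> and multiplied by \<open>P\<^sub>n D\<close>: this form
      makes sense even if some moments are infinite.\<close>
  have inv: "E n * D + e * emeasure M (A n) * P n \<le> P n * D" for n
  proof (induction n)
    case 0
    then show ?case
      by (simp add: E_def A_def G_def S_def P_def emeasure_space_1)
  next
    case (Suc n)
    have "A (Suc n) = A n \<union> B n"
      by (auto simp: A_def B_def G_def)
    moreover have "A n \<inter> B n = {}"
      by (auto simp: A_def B_def)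
    ultimately have A: "emeasure M (A (Suc n)) = emeasure M (A n) + emeasure M (B n)"
      by (simp add: plus_emeasure)
    have PS: "P (Suc n) = P n * m (Suc n)" by (simp add: P_def)
    have "E (Suc n) * D + e * emeasure M (A (Suc n)) * P (Suc n)
      = E (Suc n) * D + e * emeasure M (B n) * P (Suc n) + e * emeasure M (A n) * P (Suc n)"
      unfolding A by (simp add: distrib_left distrib_right ac_simps)
    \<comment> \<open>Only the newly stopped term has \<open>P (Suc n)\<close> replaced by
      \<open>D\<close>. The older term keeps \<open>P (Suc n)\<close>, so that
      \<open>m (Suc n)\<close> factors out and the induction hypothesis applies.\<close>
    also have "\<dots> \<le> E (Suc n) * D + e * emeasure M (B n) * D + e * emeasure M (A n) * P (Suc n)"
      by (intro add_mono mult_left_mono PD) auto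
    also have "\<dots> = (E (Suc n) + e * emeasure M (B n)) * D + e * emeasure M (A n) * P (Suc n)"
      by (simp add: distrib_right)
    also have "\<dots> \<le> E n * m (Suc n) * D + e * emeasure M (A n) * P (Suc n)"
      by (intro add_mono mult_right_mono step) auto
    also have "\<dots> = m (Suc n) * (E n * D + e * emeasure M (A n) * P n)"
      by (simp add: PS distrib_left ac_simps)
    also have "\<dots> \<le> m (Suc n) * (P n * D)"
      by (intro mult_left_mono Suc.IH) auto
    finally show ?case by (simp add: PS ac_simps)
  qed
  have bound: "emeasure M (A n) \<le> ennreal (exp (- h * u)) * D" for n
  \<comment> \<open>\<open>A 0\<close> is empty, and an infinite \<open>D\<close> makes the bound
    trivial. Otherwise \<open>0 < P n \<le> D < \<infinity>\<close>, and \<open>P n\<close> cancels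
    from \<open>inv\<close> once its first summand is dropped.\<close>
  proof (cases "n = 0 \<or> D = \<infinity>")
    case True
    then show ?thesis by (auto simp: A_def G_def ennreal_mult_top)
  next
    case False
    then have "P n \<noteq> \<infinity>" using PD[of n] by (auto simp: top_unique)
    moreover have "P n \<noteq> 0"
      using exp_moment_pos[OF \<open>prob_space M\<close> X, of _ h] by (force simp: P_def m_def)
    moreover have "P n * (e * emeasure M (A n)) \<le> P n * D"
      using order_trans[OF _ inv[of n], of "e * emeasure M (A n) * P n"] by (simp add: ac_simps)
    ultimately have "e * emeasure M (A n) \<le> D"
      using ennreal_mult_le_mult_iff by (metis infinity_ennreal_def)
    then have "ennreal (exp (- h * u)) * (e * emeasure M (A n)) \<le> ennreal (exp (- h * u)) * D"
      by (intro mult_left_mono) auto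
    moreover have "ennreal (exp (- h * u)) * e = 1"
      by (simp add: e_def ennreal_mult'[symmetric] exp_add[symmetric])
    ultimately show ?thesis by (simp add: mult.assoc[symmetric])
  qed
  have "{\<omega>\<in>space M. \<exists>k\<ge>1. u < S k \<omega>} = (\<Union>n. A n)"
    by (fastforce simp: A_def G_def not_le)
  moreover have "incseq A"
    by (auto simp: incseq_def A_def G_def)
  then have "emeasure M (\<Union>n. A n) = (SUP n. emeasure M (A n))"
    by (intro SUP_emeasure_incseq[symmetric]) auto
  ultimately have "emeasure M {\<omega>\<in>space M. \<exists>k\<ge>1. u < S k \<omega>} = (SUP n. emeasure M (A n))"
    by simp
  also have "\<dots> \<le> ennreal (exp (- h * u)) * D"
    by (intro SUP_least bound)
  finally show ?thesis by (simp add: D_def P_def m_def)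
qed


section \<open>Moments up to the adjustment coefficient and their periodic products\<close>

text \<open>The supremum in \<open>adjustment\<close> only supplies good exponents above any smaller
  \<open>h\<close>. Convexity in the exponent, with value 1 at 0, fills the gaps below them, and
  Fatou's lemma includes the endpoint.\<close>

lemma exp_moment_le_1:
  assumes "prob_space M" and X [measurable]: "X \<in> borel_measurable M"
    and "0 \<le> h" "ereal h \<le> adjustment M X"
  shows "exp_moment M (ereal h) X \<le> 1"
proof -
  interpret prob_space M by fact
  have below: "exp_moment M (ereal h) X \<le> 1" if "0 \<le> h" and less: "ereal h < adjustment M X" for h
  proof -
    obtain h' where h': "h < h'" "0 \<le> h'" "exp_moment M (ereal h') X \<le> 1"
      using less unfolding adjustment_def less_Sup_iff by auto
    \<comment> \<open>The weight that writes \<open>h\<close> as a convex combination of 0 and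
      \<open>h'\<close>.\<close>
    define t where "t = h / h'"
    have t: "0 \<le> t" "t \<le> 1" "t * h' = h"
      using h' \<open>0 \<le> h\<close> by (auto simp: t_def)
    have le: "exp (h * x) \<le> (1 - t) + t * exp (h' * x)" for x :: real
      using convex_onD[OF exp_convex, of t 0 "h' * x"] t by (simp add: mult.assoc[symmetric])
    have "exp_moment M (ereal h) X \<le> (\<integral>\<^sup>+\<omega>. ennreal (1 - t) + ennreal t * ennreal (exp (h' * X \<omega>)) \<partial>M)"
      unfolding exp_moment_ereal using t le
      by (intro nn_integral_mono) (simp add: ennreal_mult'[symmetric] ennreal_plus[symmetric] del: ennreal_plus)
    also have "\<dots> = ennreal (1 - t) + ennreal t * exp_moment M (ereal h') X"
      unfolding exp_moment_ereal by (simp add: nn_integral_add nn_integral_cmult emeasure_space_1)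
    also have "\<dots> \<le> ennreal (1 - t) + ennreal t * 1"
      using h' by (intro add_mono mult_left_mono) auto
    also have "\<dots> = 1"
      using t by (simp add: ennreal_plus[symmetric] del: ennreal_plus)
    finally show ?thesis .
  qed
  show ?thesis
  proof (cases "h = 0")
    case True
    then show ?thesis by (simp add: exp_moment_ereal emeasure_space_1)
  next
    case False
    with \<open>0 \<le> h\<close> have "h > 0" by simp
    \<comment> \<open>These exponents are nonnegative and increase to \<open>h\<close> from strictly
      below, so \<open>below\<close> covers them even when \<open>h\<close> equals the adjustment
      coefficient.\<close>
    define g where "g n = h * (1 - 1 / real (Suc n))" for n
    have g_less: "g n < h" and g_nonneg: "0 \<le> g n" for n
      using \<open>h > 0\<close> by (auto simp: g_def field_simps)
    have "g \<longlonglongrightarrow> h * (1 - 0)"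
      unfolding g_def by (intro tendsto_intros lim_1_over_n[THEN LIMSEQ_Suc])
    then have "(\<lambda>n. ennreal (exp (g n * X \<omega>))) \<longlonglongrightarrow> ennreal (exp (h * X \<omega>))" for \<omega>
      by (intro tendsto_intros) simp
    then have "exp_moment M (ereal h) X = (\<integral>\<^sup>+\<omega>. liminf (\<lambda>n. ennreal (exp (g n * X \<omega>))) \<partial>M)"
      unfolding exp_moment_ereal by (intro nn_integral_cong lim_imp_Liminf[symmetric]) auto
    also have "\<dots> \<le> liminf (\<lambda>n. exp_moment M (ereal (g n)) X)"
      unfolding exp_moment_ereal by (intro nn_integral_liminf) simp
    also have "\<dots> \<le> liminf (\<lambda>_. 1)"
    proof (intro Liminf_mono always_eventually allI below g_nonneg)
      fix n
      have "ereal (g n) < ereal h" using g_less by simp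
      with assms(4) show "ereal (g n) < adjustment M X" by (rule less_le_trans[rotated])
    qed
    finally show ?thesis by (simp add: Liminf_const)
  qed
qed

text \<open>At exponent \<open>\<infinity>\<close> the integrand is infinite wherever
  \<open>X\<close> is positive. A finite moment therefore forces \<open>X \<le> 0\<close> almost
  surely.\<close>

lemma exp_moment_le_1_of_infinity:
  assumes "prob_space M" and X [measurable]: "X \<in> borel_measurable M"
    and "0 \<le> h" and fin: "exp_moment M \<infinity> X \<noteq> \<infinity>"
  shows "exp_moment M (ereal h) X \<le> 1"
proof -
  interpret prob_space M by fact
  have eq: "exp_ereal (\<infinity> * ereal x) = (if x > 0 then \<infinity> else if x = 0 then 1 else 0)" for x
    by (cases x "0::real" rule: linorder_cases)
       (auto simp: zero_ereal_def[symmetric] exp_ereal_def)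
  have "AE \<omega> in M. exp_ereal (\<infinity> * ereal (X \<omega>)) \<noteq> \<infinity>"
    using fin unfolding exp_moment_def eq by (intro nn_integral_noteq_infinite) auto
  then have "AE \<omega> in M. X \<omega> \<le> 0"
    by eventually_elim (auto simp: eq split: if_splits)
  then have "AE \<omega> in M. ennreal (exp (h * X \<omega>)) \<le> 1"
    using \<open>0 \<le> h\<close> by (auto elim!: eventually_mono intro: mult_nonneg_nonpos)
  then have "exp_moment M (ereal h) X \<le> (\<integral>\<^sup>+\<omega>. 1 \<partial>M)"
    unfolding exp_moment_ereal by (rule nn_integral_mono_AE)
  then show ?thesis by (simp add: emeasure_space_1)
qed

text \<open>Dropping the first \<open>l\<close> factors cannot decrease the product, and periodicity
  identifies the rest with the product of the first \<open>k - l\<close> factors. Repeating this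
  leads to some index in \<open>{1..l}\<close>.\<close>

lemma SUP_prod_periodic:
  fixes m :: "nat \<Rightarrow> ennreal"
  assumes "l \<ge> 1" and per: "\<And>n. n \<ge> 1 \<Longrightarrow> m (n + l) = m n"
    and le: "(\<Prod>j=1..l. m j) \<le> 1"
  shows "(SUP k\<in>{1..}. \<Prod>j=1..k. m j) = (MAX k\<in>{1..l}. \<Prod>j=1..k. m j)" (is "?L = ?R")
proof (rule antisym)
  have "(\<Prod>j=1..k. m j) \<le> ?R" if "k \<ge> 1" for k
    using that
  proof (induction k rule: less_induct)
    case (less k)
    show ?case
    proof (cases "k \<le> l")
      case True
      with less show ?thesis by (intro Max_ge) auto
    next
      case False
      then obtain i where k: "k = i + l" "i \<ge> 1"
        using le_Suc_ex[of l k] by (auto simp: add.commute)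
      have "(\<Prod>j=1..k. m j) = (\<Prod>j=1..l. m j) * (\<Prod>j=l+1..l+i. m j)"
        using prod.ub_add_nat[of 1 l m i] k by (simp add: add.commute)
      also have "(\<Prod>j=l+1..l+i. m j) = (\<Prod>j=1..i. m j)"
        using prod.shift_bounds_cl_nat_ivl[of m 1 l i] per
        by (simp add: add.commute)
      also have "(\<Prod>j=1..l. m j) * \<dots> \<le> 1 * (\<Prod>j=1..i. m j)"
        by (intro mult_right_mono le) auto
      also have "\<dots> \<le> ?R"
        using less.IH[of i] k \<open>l \<ge> 1\<close> by simp
      finally show ?thesis .
    qed
  qed
  then show "?L \<le> ?R" by (intro SUP_least) auto
  show "?R \<le> ?L"
    using \<open>l \<ge> 1\<close> by (intro Max.boundedI) (auto intro!: SUP_upper)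
qed

section \<open>The ruin probability and its bounds\<close>

text \<open>The hypothesis \<open>jumps_after_increase\<close> excludes paths that decrease below
  zero inside an interval and jump back up at its right end: such ruin could be invisible at the
  times \<open>T k\<close>. \<open>H\<close> consists of real exponents, so for
  \<open>L = \<infinity>\<close> it is the whole half-line.\<close>

theorem corollary2:
  fixes M :: "'a measure"
    and R :: "real \<Rightarrow> 'a \<Rightarrow> real"
    and T :: "nat \<Rightarrow> 'a \<Rightarrow> real"
    and u :: real
    and l :: nat
  assumes "prob_space M"
    and "u > 0"
    and process: "\<And>t. t \<ge> 0 \<Longrightarrow> R t \<in> borel_measurable M"
    and initial: "AE \<omega> in M. R 0 \<omega> = u"
    and ruin_event: "{\<omega> \<in> space M. ruin R \<omega>} \<in> sets M"
    and times: "\<And>k. T k \<in> borel_measurable M"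
    and T_0: "\<And>\<omega>. \<omega> \<in> space M \<Longrightarrow> T 0 \<omega> = 0"
    and T_increasing: "AE \<omega> in M. \<forall>k. T k \<omega> < T (Suc k) \<omega>"
    and T_unbounded: "AE \<omega> in M. filterlim (\<lambda>n. T n \<omega>) at_top sequentially"
    and jumps: "AE \<omega> in M. \<forall>t. positive_jump (\<lambda>s. R s \<omega>) t \<longrightarrow> (\<exists>k\<ge>1. t = T k \<omega>)"
    and monotone: "AE \<omega> in M. \<forall>k\<ge>1.
          mono_on {T (k - 1) \<omega>..<T k \<omega>} (\<lambda>s. R s \<omega>) \<or>
          antimono_on {T (k - 1) \<omega>..<T k \<omega>} (\<lambda>s. R s \<omega>)"
    and jumps_after_increase: "AE \<omega> in M. \<forall>k\<ge>1.
          positive_jump (\<lambda>s. R s \<omega>) (T k \<omega>) \<longrightarrow>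
          mono_on {T (k - 1) \<omega>..<T k \<omega>} (\<lambda>s. R s \<omega>)"
    and independent: "prob_space.indep_vars M (\<lambda>_. borel) (net_loss R T) {1..}"
    and "l \<ge> 1"
    and periodic: "\<And>n. n \<ge> 1 \<Longrightarrow>
          distr M borel (net_loss R T (n + l)) = distr M borel (net_loss R T n)"
  shows "let Y = net_loss R T; S = total_loss R T; L = adjustment M (S l);
             C\<^sub>1 = (MAX k\<in>{1..l}. exp_moment M L (S k));
             H = {h::real. 0 \<le> h \<and> ereal h \<le> L}
         in ruin_prob M R u = \<P>(\<omega> in M. (SUP k\<in>{1..}. ereal (S k \<omega>)) > ereal u)
          \<and> (\<forall>h\<ge>0.
               ennreal (ruin_prob M R u)
                 \<le> ennreal (exp (- h * u)) * (SUP k\<in>{1..}. exp_moment M (ereal h) (S k))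
             \<and> ennreal (exp (- h * u)) * (SUP k\<in>{1..}. exp_moment M (ereal h) (S k))
                 = ennreal (exp (- h * u)) * (SUP k\<in>{1..}. \<Prod>j=1..k. exp_moment M (ereal h) (Y j)))
          \<and> (\<forall>h\<in>H. (SUP k\<in>{1..}. exp_moment M (ereal h) (S k))
                      = (MAX k\<in>{1..l}. exp_moment M (ereal h) (S k)))
          \<and> ennreal (ruin_prob M R u)
              \<le> (INF h\<in>H. ennreal (exp (- h * u)) * (MAX k\<in>{1..l}. exp_moment M (ereal h) (S k)))
          \<and> (INF h\<in>H. ennreal (exp (- h * u)) * (MAX k\<in>{1..l}. exp_moment M (ereal h) (S k)))
              \<le> bound_times C\<^sub>1 (exp_ereal (- L * ereal u))"
proof -
  interpret prob_space M by fact
  define Y where "Y = net_loss R T"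
  define S where "S = total_loss R T"
  define L where "L = adjustment M (S l)"
  define H where "H = {h::real. 0 \<le> h \<and> ereal h \<le> L}"
  define C where "C h = (MAX k\<in>{1..l}. exp_moment M h (S k))" for h
  have indep: "indep_vars (\<lambda>_. borel) Y {1..}"
    using independent by (simp add: Y_def)
  have Y [measurable]: "Y j \<in> borel_measurable M" if "j \<ge> 1" for j
    using indep that by (auto simp: indep_vars_def)
  have S_eq: "S k = (\<lambda>\<omega>. \<Sum>j=1..k. Y j \<omega>)" for k
    by (simp add: S_def Y_def total_loss_def fun_eq_iff)
  have S [measurable]: "S k \<in> borel_measurable M" for k
    unfolding S_eq by (intro borel_measurable_sum Y) auto
  have exp_S: "exp_moment M (ereal h) (S k) = (\<Prod>j=1..k. exp_moment M (ereal h) (Y j))" for h k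
    unfolding S_eq by (rule exp_moment_sum[OF \<open>prob_space M\<close> indep])
  \<comment> \<open>The moment depends on the law of \<open>Y j\<close> alone, so equality of
    distributions carries over to moments.\<close>
  have exp_Y: "exp_moment M (ereal h) (Y j) = (\<integral>\<^sup>+x. ennreal (exp (h * x)) \<partial>distr M borel (Y j))"
    if "j \<ge> 1" for h j
    using that by (simp add: exp_moment_ereal nn_integral_distr)
  have S_path: "S k \<omega> = R (T 0 \<omega>) \<omega> - R (T k \<omega>) \<omega>" for k \<omega>
    unfolding S_eq Y_def by (induction k) (simp_all add: net_loss_def)
  have SUP_iff: "(SUP k\<in>{1..}. ereal (S k \<omega>)) > ereal u \<longleftrightarrow> (\<exists>k\<ge>1. u < S k \<omega>)" for \<omega>
    by (auto simp: less_SUP_iff)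
  have "AE \<omega> in M. ruin R \<omega> \<longleftrightarrow> (\<exists>k\<ge>1. u < S k \<omega>)"
    using initial T_increasing T_unbounded monotone jumps_after_increase AE_space
  proof eventually_elim
    case (elim \<omega>)
    have "ruin R \<omega> \<longleftrightarrow> (\<exists>k. R (T k \<omega>) \<omega> < 0)"
      unfolding ruin_def zero_ereal_def
      by (rule INF_path_less_iff) (use elim T_0 in auto)
    also have "\<dots> \<longleftrightarrow> (\<exists>k. u < S k \<omega>)"
      using elim by (simp add: S_path T_0)
    \<comment> \<open>The index 0 drops out because \<open>S 0 = 0 < u\<close>.\<close>
    also have "\<dots> \<longleftrightarrow> (\<exists>k\<ge>1. u < S k \<omega>)"
      using \<open>u > 0\<close> by (metis S_path cancel_comm_monoid_add_class.diff_cancel less_one not_less order.asym)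
    finally show ?case .
  qed
  \<comment> \<open>The condition \<open>R 0 = u\<close> holds almost surely, so it may be replaced
    by \<open>True\<close>.\<close>
  then have "ruin_prob M R u = \<P>(\<omega> in M. \<exists>k\<ge>1. u < S k \<omega> \<bar> True)"
    unfolding ruin_prob_def using ruin_event initial process[of 0]
    by (intro cond_prob_eq_AE) auto
  then have ruin_eq: "ruin_prob M R u = \<P>(\<omega> in M. \<exists>k\<ge>1. u < S k \<omega>)"
    by (simp add: cond_prob_def prob_space)
  have bound: "ennreal (ruin_prob M R u)
      \<le> ennreal (exp (- h * u)) * (SUP k\<in>{1..}. exp_moment M (ereal h) (S k))" if "h \<ge> 0" for h
    using maximal_inequality_exp_sum[OF \<open>prob_space M\<close> indep that, of u]
    unfolding ruin_eq exp_S emeasure_eq_measure S_eq[symmetric] by (simp add: S_eq)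
  have SUP_eq: "(SUP k\<in>{1..}. exp_moment M (ereal h) (S k)) = C (ereal h)" if "h \<in> H" for h
    unfolding C_def exp_S
  proof (rule SUP_prod_periodic[OF \<open>l \<ge> 1\<close>])
    show "exp_moment M (ereal h) (Y (n + l)) = exp_moment M (ereal h) (Y n)" if "n \<ge> 1" for n
      using that periodic[OF that] by (simp add: exp_Y Y_def[symmetric])
    show "(\<Prod>j=1..l. exp_moment M (ereal h) (Y j)) \<le> 1"
      using exp_moment_le_1[OF \<open>prob_space M\<close> S, of h l] \<open>h \<in> H\<close>
      by (simp add: exp_S H_def L_def)
  qed
  have "0 \<le> L"
    unfolding L_def adjustment_def
    by (rule Sup_upper) (auto intro!: exI[of _ 0] simp: exp_moment_ereal emeasure_space_1)
  have last: "(INF h\<in>H. ennreal (exp (- h * u)) * C (ereal h)) \<le> bound_times (C L) (exp_ereal (- L * ereal u))"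
    (is "?I \<le> _")
  \<comment> \<open>An infinite constant gives the trivial bound. For real \<open>L\<close> the
    choice \<open>h = L\<close> suffices; for \<open>L = \<infinity>\<close> no such
    \<open>h\<close> is available in \<open>H\<close>, and the infimum is shown to vanish.\<close>
  proof (cases "C L = \<infinity>")
    case True
    then show ?thesis by (simp add: bound_times_def)
  next
    case fin: False
    show ?thesis
    proof (cases L)
      case (real x)
      then have "x \<in> H" using \<open>0 \<le> L\<close> by (simp add: H_def)
      then have "?I \<le> ennreal (exp (- x * u)) * C (ereal x)" by (rule INF_lower)
      then show ?thesis using fin real by (simp add: bound_times_def mult.commute)
    next
      case PInf
      \<comment> \<open>Finiteness of \<open>C L\<close> at \<open>L = \<infinity>\<close> makes
        every moment at a real exponent at most 1. Taking \<open>h = n\<close> then bounds the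
        infimum by powers of \<open>exp (- u)\<close>, which tend to 0.\<close>
      have C: "C (ereal h) \<le> 1" if "h \<ge> 0" for h
        unfolding C_def
      proof (intro Max.boundedI)
        fix a assume "a \<in> (\<lambda>k. exp_moment M (ereal h) (S k)) ` {1..l}"
        then obtain k where k: "k \<in> {1..l}" "a = exp_moment M (ereal h) (S k)" by auto
        have "exp_moment M L (S k) \<le> C L"
          unfolding C_def using k by (intro Max_ge) auto
        then have "exp_moment M \<infinity> (S k) \<noteq> \<infinity>"
          using fin PInf by (auto simp: top_unique)
        then show "a \<le> 1"
          using exp_moment_le_1_of_infinity[OF \<open>prob_space M\<close> S \<open>h \<ge> 0\<close>] k by blast
      qed (use \<open>l \<ge> 1\<close> in auto)
      have "?I \<le> ennreal (exp (- u) ^ n)" for n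
      proof -
        have "real n \<in> H" using PInf by (simp add: H_def)
        then have "?I \<le> ennreal (exp (- real n * u)) * C (ereal (real n))" by (rule INF_lower)
        also have "\<dots> \<le> ennreal (exp (- real n * u)) * 1"
          by (intro mult_left_mono C) auto
        finally show ?thesis by (simp add: exp_of_nat_mult[symmetric])
      qed
      moreover have "(\<lambda>n. ennreal (exp (- u) ^ n)) \<longlonglongrightarrow> ennreal 0"
        using \<open>u > 0\<close> by (intro tendsto_ennrealI LIMSEQ_power_zero) simp
      ultimately have "?I \<le> 0"
        by (intro LIMSEQ_le_const[where X = "\<lambda>n. ennreal (exp (- u) ^ n)"]) auto
      then show ?thesis by simp
    qed (use \<open>0 \<le> L\<close> in auto)
  qed
  have "ennreal (ruin_prob M R u) \<le> (INF h\<in>H. ennreal (exp (- h * u)) * C (ereal h))"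
  proof (rule INF_greatest)
    fix h assume "h \<in> H"
    then have "h \<ge> 0" by (simp add: H_def)
    from bound[OF this] show "ennreal (ruin_prob M R u) \<le> ennreal (exp (- h * u)) * C (ereal h)"
      unfolding SUP_eq[OF \<open>h \<in> H\<close>] .
  qed
  then show ?thesis
    unfolding Let_def Y_def[symmetric] S_def[symmetric] L_def[symmetric] H_def[symmetric]
      C_def[symmetric] SUP_iff
    using ruin_eq bound SUP_eq last by (auto simp: exp_S)
qed

end
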